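(* Let $m,k<\omega$ be such that $2\le k\le 2^m+1$. Then $\mathrm{Log}\,\mathcal C_k$ does not have $\mathrm{LPP}(1,m)$, where $\mathcal C_k$ is the $k$-element cluster, i.e. the Kripke frame $(\{0,\dots,k-1\},R)$ with $R=\{0,\dots,k-1\}\times\{0,\dots,k-1\}$.
   Context: Formulas. Fix a countably infinite set $\mathcal V$ of propositional variables. A literal is a variable $p$ or its negation $\neg p$. Modal formulas are built from literals and $\bot,\top$ using $\wedge,\vee,\Diamond,\Box$; negation of an arbitrary formula is defined by the duality laws, and $\varphi\to\psi$ is $\neg\varphi\vee\psi$. $\mathrm{lits}(\varphi)$ is the set of literals occurring in $\varphi$. $\varphi(\vec p,\bar r)$ means that all variables of $\varphi$ are among $\vec p,\bar r$; substitution is simultaneous with negations expanded. Logics. A modal logic is a set $\Lambda$ of formulas containing all classical tautologies and closed under modus ponens, uniform substitution and the rule: from $\varphi\leftrightarrow\psi$ infer $\Diamond\varphi\leftrightarrow\Diamond\psi$. $\Lambda\vdash\varphi$ means $\varphi\in\Lambda$. $\Lambda$ is monotone if it contains $\Diamond p\to\Diamond(p\vee q)$. $\mathrm{Log}\,\mathcal F$ is the set of formulas valid in the Kripke frame $\mathcal F$ under the usual Kripke semantics; it is a modal logic, and it is monotone. LPP. Let $\vec p=(p_i)_{i<n'}$, $\bar r=(r_j)_{j<m'}$ be finite tuples of pairwise distinct variables. A formula $\varphi(\vec p,\bar r)$ is $\vec p$-positive if no $\neg p_i$ is in $\mathrm{lits}(\varphi)$. It is $\vec p$-monotone in $\Lambda$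 if $\Lambda\vdash\varphi(\vec p,\bar r)\to\varphi(\vec p\vee\vec q,\bar r)$, where $\vec q$ is a tuple of fresh distinct variables of the same length as $\vec p$ and $\vec p\vee\vec q=(p_i\vee q_i)_{i<n'}$. For $n,m\le\omega$, a monotone logic $\Lambda$ has $\mathrm{LPP}(n,m)$ if for all finite $n'\le n$, $m'\le m$ and tuples $\vec p=(p_i)_{i<n'}$, $\bar r=(r_j)_{j<m'}$, every formula $\varphi(\vec p,\bar r)$ that is $\vec p$-monotone in $\Lambda$ is $\Lambda$-equivalent (i.e. $\Lambda\vdash\varphi\leftrightarrow\alpha$) to some $\vec p$-positive formula $\alpha(\vec p,\bar r)$. *)

theory Defs
  imports Main "HOL-Library.Extended_Nat"
begin

datatype lit = PosLit nat | NegLit nat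

text \<open>Formulas are in negation normal form: propositional variables are natural numbers,
  negation occurs in literals only, and negation of arbitrary formulas, implication and
  equivalence are operations on formulas.\<close>

datatype fm = Lit lit | Bot | Top | And fm fm | Or fm fm | Dia fm | Box fm

abbreviation Var :: "nat \<Rightarrow> fm" where
  "Var p \<equiv> Lit (PosLit p)"

fun neg :: "fm \<Rightarrow> fm" where
  "neg (Lit (PosLit p)) = Lit (NegLit p)"
| "neg (Lit (NegLit p)) = Lit (PosLit p)"
| "neg Bot = Top"
| "neg Top = Bot"
| "neg (And a b) = Or (neg a) (neg b)"
| "neg (Or a b) = And (neg a) (neg b)"
| "neg (Dia a) = Box (neg a)"
| "neg (Box a) = Dia (neg a)"

definition Imp :: "fm \<Rightarrow> fm \<Rightarrow> fm" where
  "Imp a b = Or (neg a) b"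

definition Iff :: "fm \<Rightarrow> fm \<Rightarrow> fm" where
  "Iff a b = And (Imp a b) (Imp b a)"

fun lits :: "fm \<Rightarrow> lit set" where
  "lits (Lit l) = {l}"
| "lits Bot = {}"
| "lits Top = {}"
| "lits (And a b) = lits a \<union> lits b"
| "lits (Or a b) = lits a \<union> lits b"
| "lits (Dia a) = lits a"
| "lits (Box a) = lits a"

definition vars :: "fm \<Rightarrow> nat set" where
  "vars a = {p. PosLit p \<in> lits a \<or> NegLit p \<in> lits a}"

fun subst :: "(nat \<Rightarrow> fm) \<Rightarrow> fm \<Rightarrow> fm" where
  "subst s (Lit (PosLit p)) = s p"
| "subst s (Lit (NegLit p)) = neg (s p)"
| "subst s Bot = Bot"
| "subst s Top = Top"
| "subst s (And a b) = And (subst s a) (subst s b)"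
| "subst s (Or a b) = Or (subst s a) (subst s b)"
| "subst s (Dia a) = Dia (subst s a)"
| "subst s (Box a) = Box (subst s a)"

fun modality_free :: "fm \<Rightarrow> bool" where
  "modality_free (And a b) \<longleftrightarrow> modality_free a \<and> modality_free b"
| "modality_free (Or a b) \<longleftrightarrow> modality_free a \<and> modality_free b"
| "modality_free (Dia a) \<longleftrightarrow> False"
| "modality_free (Box a) \<longleftrightarrow> False"
| "modality_free _ \<longleftrightarrow> True"

text \<open>The values on modal formulas are irrelevant; \<^const>\<open>modality_free\<close> excludes them
  from being tautologies.\<close>

fun ctrue :: "(nat \<Rightarrow> bool) \<Rightarrow> fm \<Rightarrow> bool" where
  "ctrue v (Lit (PosLit p)) \<longleftrightarrow> v p"
| "ctrue v (Lit (NegLit p)) \<longleftrightarrow> \<not> v p"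
| "ctrue v Bot \<longleftrightarrow> False"
| "ctrue v Top \<longleftrightarrow> True"
| "ctrue v (And a b) \<longleftrightarrow> ctrue v a \<and> ctrue v b"
| "ctrue v (Or a b) \<longleftrightarrow> ctrue v a \<or> ctrue v b"
| "ctrue v (Dia a) \<longleftrightarrow> False"
| "ctrue v (Box a) \<longleftrightarrow> False"

definition classical_tautology :: "fm \<Rightarrow> bool" where
  "classical_tautology a \<longleftrightarrow> modality_free a \<and> (\<forall>v. ctrue v a)"

definition modal_logic :: "fm set \<Rightarrow> bool" where
  "modal_logic L \<longleftrightarrow>
     (\<forall>a. classical_tautology a \<longrightarrow> a \<in> L) \<and>
     (\<forall>a b. a \<in> L \<longrightarrow> Imp a b \<in> L \<longrightarrow> b \<in> L) \<and>
     (\<forall>a s. a \<in> L \<longrightarrow> subst s a \<in> L) \<and>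
     (\<forall>a b. Iff a b \<in> L \<longrightarrow> Iff (Dia a) (Dia b) \<in> L)"

definition monotone_logic :: "fm set \<Rightarrow> bool" where
  "monotone_logic L \<longleftrightarrow> modal_logic L \<and>
     (\<forall>p q. p \<noteq> q \<longrightarrow> Imp (Dia (Var p)) (Dia (Or (Var p) (Var q))) \<in> L)"

type_synonym 'w frame = "'w set \<times> ('w \<times> 'w) set"

fun sat :: "'w frame \<Rightarrow> (nat \<Rightarrow> 'w set) \<Rightarrow> 'w \<Rightarrow> fm \<Rightarrow> bool" where
  "sat F V w (Lit (PosLit p)) \<longleftrightarrow> w \<in> V p"
| "sat F V w (Lit (NegLit p)) \<longleftrightarrow> w \<notin> V p"
| "sat F V w Bot \<longleftrightarrow> False"
| "sat F V w Top \<longleftrightarrow> True"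
| "sat F V w (And a b) \<longleftrightarrow> sat F V w a \<and> sat F V w b"
| "sat F V w (Or a b) \<longleftrightarrow> sat F V w a \<or> sat F V w b"
| "sat F V w (Dia a) \<longleftrightarrow> (\<exists>u \<in> fst F. (w, u) \<in> snd F \<and> sat F V u a)"
| "sat F V w (Box a) \<longleftrightarrow> (\<forall>u \<in> fst F. (w, u) \<in> snd F \<longrightarrow> sat F V u a)"

definition Log :: "'w frame \<Rightarrow> fm set" where
  "Log F = {a. \<forall>V. (\<forall>p. V p \<subseteq> fst F) \<longrightarrow> (\<forall>w \<in> fst F. sat F V w a)}"

definition cluster :: "nat \<Rightarrow> nat frame" where
  "cluster k = ({..<k}, {..<k} \<times> {..<k})"

definition positive_in :: "nat list \<Rightarrow> fm \<Rightarrow> bool" where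
  "positive_in ps a \<longleftrightarrow> (\<forall>p \<in> set ps. NegLit p \<notin> lits a)"

definition join_subst :: "nat list \<Rightarrow> nat list \<Rightarrow> nat \<Rightarrow> fm" where
  "join_subst ps qs v = (case map_of (zip ps qs) v of
     None \<Rightarrow> Var v | Some q \<Rightarrow> Or (Var v) (Var q))"

text \<open>Freshness of \<open>qs\<close> is relative to the displayed variables \<open>ps\<close>, \<open>rs\<close>. As a logic is closed
  under uniform substitution, it does not matter which fresh tuple is taken.\<close>

definition monotone_in :: "fm set \<Rightarrow> nat list \<Rightarrow> nat list \<Rightarrow> fm \<Rightarrow> bool" where
  "monotone_in L ps rs a \<longleftrightarrow>
     (\<forall>qs. length qs = length ps \<and> distinct qs \<and> set qs \<inter> (set ps \<union> set rs) = {} \<longrightarrow>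
        Imp a (subst (join_subst ps qs) a) \<in> L)"

text \<open>The property is meant for monotone logics only. This is not part of the definition, so that
  a negated \<open>LPP\<close> is never true merely because \<open>L\<close> fails to be a monotone logic.\<close>

definition LPP :: "fm set \<Rightarrow> enat \<Rightarrow> enat \<Rightarrow> bool" where
  "LPP L n m \<longleftrightarrow>
     (\<forall>ps rs a. enat (length ps) \<le> n \<and> enat (length rs) \<le> m \<and> distinct (ps @ rs) \<and>
        vars a \<subseteq> set ps \<union> set rs \<and> monotone_in L ps rs a \<longrightarrow>
        (\<exists>b. vars b \<subseteq> set ps \<union> set rs \<and> positive_in ps b \<and> Iff a b \<in> L))"

lemma sat_neg: "sat F V w (neg a) \<longleftrightarrow> \<not> sat F V w a"
  by (induction a arbitrary: w rule: neg.induct) auto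

lemma sat_Imp: "sat F V w (Imp a b) \<longleftrightarrow> (sat F V w a \<longrightarrow> sat F V w b)"
  by (auto simp: Imp_def sat_neg)

lemma sat_Iff: "sat F V w (Iff a b) \<longleftrightarrow> (sat F V w a \<longleftrightarrow> sat F V w b)"
  by (auto simp: Iff_def sat_Imp)

lemma sat_subst:
  "w \<in> fst F \<Longrightarrow> sat F V w (subst s a) \<longleftrightarrow> sat F (\<lambda>p. {u \<in> fst F. sat F V u (s p)}) w a"
  by (induction s a arbitrary: w rule: subst.induct) (auto simp: sat_neg)

lemma sat_modality_free:
  "modality_free a \<Longrightarrow> sat F V w a \<longleftrightarrow> ctrue (\<lambda>p. w \<in> V p) a"
  by (induction "\<lambda>p. w \<in> V p" a rule: ctrue.induct) auto

lemma monotone_logic_Log: "monotone_logic (Log F)"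
proof -
  have "subst s a \<in> Log F" if "a \<in> Log F" for s a
    using that unfolding Log_def by (auto simp: sat_subst)
  then show ?thesis
    unfolding monotone_logic_def modal_logic_def classical_tautology_def
    by (auto simp: Log_def sat_modality_free sat_Imp sat_Iff)
qed

end

theory Submission
  imports Defs
begin

text \<open>The idea is to use up all worlds of the cluster but one. The \<open>m\<close> parameters \<open>r\<^sub>j\<close> distinguish
  \<open>2 ^ m\<close> types of worlds, so \<open>k - 1\<close> types \<open>t\<^sub>0, \<dots>, t\<^sub>k\<^sub>-\<^sub>2\<close> are available. If each of them is realized in the
  \<open>k\<close>-element cluster, then at most two worlds have type \<open>t\<^sub>0\<close>. Consider the formula saying that all
  these types are realized, that the current world \<open>w\<close> has type \<open>t\<^sub>0\<close>, and that

    \<^item> either \<open>p\<close> fails at \<open>w\<close> and holds at some world of type \<open>t\<^sub>0\<close>,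
    \<^item> or \<open>p\<close> holds at all worlds of type \<open>t\<^sub>0\<close>.

  Enlarging the extension of \<open>p\<close> clearly preserves the second alternative. In the first one,
  if \<open>p\<close> becomes true at \<open>w\<close>, it is then true at both worlds of type \<open>t\<^sub>0\<close>, and the second
  alternative takes over. Hence the formula is monotone in \<open>p\<close>
  (\<open>monotone_in_counterexample\<close>).

  On the other hand, let two worlds \<open>w\<close>, \<open>u\<close> share type \<open>t\<^sub>0\<close>, and let \<open>p\<close> hold at \<open>u\<close> only. The formula holds
  at \<open>w\<close> and fails at \<open>u\<close>. But \<open>w\<close> and \<open>u\<close> see the same worlds, and \<open>u\<close> satisfies every positive
  literal that \<open>w\<close> satisfies, so a \<open>p\<close>-positive formula true at \<open>w\<close> is also true at \<open>u\<close>
  (\<open>sat_cluster_positive_mono\<close>). The comparison is between two worlds of a single model: it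
  is a directed bisimulation that cannot be produced by enlarging \<open>p\<close> on so few worlds.\<close>

section \<open>Positive formulas in a cluster\<close>

lemma sat_cluster_Dia [simp]:
  "w < k \<Longrightarrow> sat (cluster k) V w (Dia a) \<longleftrightarrow> (\<exists>u<k. sat (cluster k) V u a)"
  by (auto simp: cluster_def)

lemma sat_cluster_Box [simp]:
  "w < k \<Longrightarrow> sat (cluster k) V w (Box a) \<longleftrightarrow> (\<forall>u<k. sat (cluster k) V u a)"
  by (auto simp: cluster_def)

text \<open>Modal subformulas have the same truth value at all worlds of a cluster, so only the literals
  outside the scope of modalities matter for the comparison of two worlds.\<close>

lemma sat_cluster_positive_mono:
  assumes "w < k" "u < k"
    and "\<And>l. l \<in> lits a \<Longrightarrow> sat (cluster k) V w (Lit l) \<Longrightarrow> sat (cluster k) V u (Lit l)"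
    and "sat (cluster k) V w a"
  shows "sat (cluster k) V u a"
  using assms by (induction a) (auto simp del: sat.simps(7,8))

section \<open>Types of worlds\<close>

definition Conj :: "fm list \<Rightarrow> fm" where
  "Conj as = foldr And as Top"

lemma sat_Conj [simp]: "sat F V w (Conj as) \<longleftrightarrow> (\<forall>a \<in> set as. sat F V w a)"
  by (induction as) (auto simp: Conj_def)

lemma lits_Conj [simp]: "lits (Conj as) = (\<Union>a \<in> set as. lits a)"
  by (induction as) (auto simp: Conj_def)

text \<open>The parameter \<open>r\<^sub>j\<close> is the variable \<open>Suc j\<close>, the variable \<open>0\<close> being kept for \<open>p\<close>. The number of a
  type is read in binary: its digit \<open>j\<close> is the truth value of \<open>r\<^sub>j\<close>.\<close>

definition type_fm :: "nat \<Rightarrow> nat \<Rightarrow> fm" where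
  "type_fm m i = Conj (map (\<lambda>j. Lit (if bit i j then PosLit (Suc j) else NegLit (Suc j))) [0..<m])"

lemma sat_type_fm:
  "sat F V w (type_fm m i) \<longleftrightarrow> (\<forall>j<m. w \<in> V (Suc j) \<longleftrightarrow> bit i j)"
  by (auto simp: type_fm_def)

lemma vars_type_fm: "vars (type_fm m i) \<subseteq> Suc ` {..<m}"
  by (auto simp: vars_def type_fm_def split: if_splits)

lemma eq_if_low_bits_eq:
  fixes i i' :: nat
  assumes "i < 2 ^ m" "i' < 2 ^ m" "\<And>j. j < m \<Longrightarrow> bit i j \<longleftrightarrow> bit i' j"
  shows "i = i'"
proof -
  have "take_bit m i = take_bit m i'"
    using assms(3) by (auto simp: bit_eq_iff bit_take_bit_iff)
  with assms(1,2) show ?thesis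
    by (simp add: take_bit_nat_eq_self)
qed

lemma type_fm_unique:
  assumes "sat F V w (type_fm m i)" "sat F V w (type_fm m i')" "i < 2 ^ m" "i' < 2 ^ m"
  shows "i = i'"
  using assms eq_if_low_bits_eq[of i m i'] by (auto simp: sat_type_fm)

text \<open>Representatives of the remaining \<open>n - 1\<close> classes leave room for two elements of \<open>A 0\<close>.\<close>

lemma at_most_two_in_class:
  assumes "finite W" "card W \<le> n + 1" "0 < n"
    and sub: "\<And>i. i < n \<Longrightarrow> A i \<subseteq> W"
    and nonempty: "\<And>i. i < n \<Longrightarrow> A i \<noteq> {}"
    and disj: "\<And>i i'. i < n \<Longrightarrow> i' < n \<Longrightarrow> A i \<inter> A i' \<noteq> {} \<Longrightarrow> i = i'"
  shows "card (A 0) \<le> 2"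
proof -
  define g where "g i = (SOME x. x \<in> A i)" for i
  have g: "g i \<in> A i" if "i < n" for i
    using nonempty[OF that] some_in_eq[of "A i"] by (simp add: g_def)
  have "inj_on g {1..<n}"
    using g disj by (intro inj_onI) (metis IntI atLeastLessThan_iff empty_iff)
  then have card_g: "card (g ` {1..<n}) = n - 1"
    by (simp add: card_image)
  have "A 0 \<inter> g ` {1..<n} = {}"
    using g disj[OF \<open>0 < n\<close>] by fastforce
  moreover have "finite (A 0)"
    using sub \<open>0 < n\<close> \<open>finite W\<close> finite_subset by blast
  ultimately have "card (A 0 \<union> g ` {1..<n}) = card (A 0) + (n - 1)"
    using card_g by (simp add: card_Un_disjoint)
  moreover have "A 0 \<union> g ` {1..<n} \<subseteq> W"
    using sub g \<open>0 < n\<close> by fastforce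
  ultimately have "card (A 0) + (n - 1) \<le> card W"
    using card_mono[OF \<open>finite W\<close>] by metis
  with assms(2,3) show ?thesis
    by linarith
qed

lemma type_0_pigeonhole:
  assumes "0 < n" "n \<le> 2 ^ m" "k \<le> n + 1"
    and real: "\<And>i. i < n \<Longrightarrow> \<exists>x<k. sat (cluster k) V x (type_fm m i)"
    and "w < k" "sat (cluster k) V w (type_fm m 0)"
    and "u < k" "sat (cluster k) V u (type_fm m 0)"
    and "x < k" "sat (cluster k) V x (type_fm m 0)"
    and "w \<noteq> u"
  shows "x = w \<or> x = u"
proof (rule ccontr)
  assume "\<not> (x = w \<or> x = u)"
  define A where "A i = {y. y < k \<and> sat (cluster k) V y (type_fm m i)}" for i
  have "card (A 0) \<le> 2"
  proof (rule at_most_two_in_class[where W = "{..<k}" and n = n])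
    show "A i \<subseteq> {..<k}" for i
      by (auto simp: A_def)
    show "A i \<noteq> {}" if "i < n" for i
      using real[OF that] by (auto simp: A_def)
    show "i = i'" if "i < n" "i' < n" "A i \<inter> A i' \<noteq> {}" for i i'
      using that \<open>n \<le> 2 ^ m\<close> type_fm_unique[of "cluster k" V _ m i i'] by (auto simp: A_def)
  qed (use assms in auto)
  moreover have "card {w, u, x} \<le> card (A 0)"
    using assms by (intro card_mono) (auto simp: A_def)
  ultimately show False
    using \<open>w \<noteq> u\<close> \<open>\<not> (x = w \<or> x = u)\<close> by auto
qed

section \<open>The counterexample\<close>

definition counterexample :: "nat \<Rightarrow> nat \<Rightarrow> fm" where
  "counterexample m n =
     And (And (type_fm m 0) (Conj (map (\<lambda>i. Dia (type_fm m i)) [0..<n])))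
       (Or (And (Lit (NegLit 0)) (Dia (And (type_fm m 0) (Var 0))))
           (Box (Imp (type_fm m 0) (Var 0))))"

lemma sat_counterexample:
  assumes "w < k"
  shows "sat (cluster k) V w (counterexample m n) \<longleftrightarrow>
    sat (cluster k) V w (type_fm m 0) \<and>
    (\<forall>i<n. \<exists>u<k. sat (cluster k) V u (type_fm m i)) \<and>
    (w \<notin> V 0 \<and> (\<exists>u<k. sat (cluster k) V u (type_fm m 0) \<and> u \<in> V 0) \<or>
     (\<forall>u<k. sat (cluster k) V u (type_fm m 0) \<longrightarrow> u \<in> V 0))"
  using assms by (auto simp: counterexample_def sat_Imp simp del: sat.simps(7,8))

lemma vars_neg [simp]: "vars (neg a) = vars a"
  by (induction a rule: neg.induct) (auto simp: vars_def)

lemma vars_counterexample: "vars (counterexample m n) \<subseteq> insert 0 (Suc ` {..<m})"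
proof -
  have "vars (counterexample m n) \<subseteq> insert 0 (\<Union>i. vars (type_fm m i) \<union> vars (neg (type_fm m i)))"
    unfolding counterexample_def Imp_def by (auto simp: vars_def)
  then show ?thesis
    using vars_type_fm by fastforce
qed

lemma counterexample_mono:
  assumes "0 < n" "n \<le> 2 ^ m" "k \<le> n + 1" "w < k"
    and p: "V 0 \<subseteq> V' 0"
    and r: "\<And>j u. j < m \<Longrightarrow> u < k \<Longrightarrow> u \<in> V' (Suc j) \<longleftrightarrow> u \<in> V (Suc j)"
    and sat: "sat (cluster k) V w (counterexample m n)"
  shows "sat (cluster k) V' w (counterexample m n)"
proof -
  have types: "sat (cluster k) V' u (type_fm m i) \<longleftrightarrow> sat (cluster k) V u (type_fm m i)"
    if "u < k" for u i
    using r that by (simp add: sat_type_fm)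
  have w: "sat (cluster k) V w (type_fm m 0)"
    and real: "\<And>i. i < n \<Longrightarrow> \<exists>x<k. sat (cluster k) V x (type_fm m i)"
    using sat \<open>w < k\<close> by (auto simp: sat_counterexample)
  consider
      (mixed) u where "w \<notin> V 0" "u < k" "sat (cluster k) V u (type_fm m 0)" "u \<in> V 0"
    | (full) "\<forall>u<k. sat (cluster k) V u (type_fm m 0) \<longrightarrow> u \<in> V 0"
    using sat \<open>w < k\<close> by (auto simp: sat_counterexample)
  then have "w \<notin> V' 0 \<and> (\<exists>u<k. sat (cluster k) V u (type_fm m 0) \<and> u \<in> V' 0) \<or>
     (\<forall>u<k. sat (cluster k) V u (type_fm m 0) \<longrightarrow> u \<in> V' 0)"
  proof cases
    case mixed
    \<comment> \<open>Here \<open>w\<close> and \<open>u\<close> are the only worlds of type \<open>0\<close>, so \<open>p\<close> is full on this type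
      as soon as it is true at \<open>w\<close>.\<close>
    have "x = w \<or> x = u" if "x < k" "sat (cluster k) V x (type_fm m 0)" for x
      using mixed type_0_pigeonhole[OF assms(1-3) real \<open>w < k\<close> w _ _ that] by metis
    then show ?thesis
      using mixed p by blast
  next
    case full
    then show ?thesis
      using p by blast
  qed
  then show ?thesis
    using w real \<open>w < k\<close> types by (simp add: sat_counterexample cong: conj_cong)
qed

lemma monotone_in_counterexample:
  assumes "0 < n" "n \<le> 2 ^ m" "k \<le> n + 1"
  shows "monotone_in (Log (cluster k)) [0] (map Suc [0..<m]) (counterexample m n)"
  unfolding monotone_in_def
proof (intro allI impI)
  fix qs :: "nat list"
  assume "length qs = length [0] \<and> distinct qs \<and>
    set qs \<inter> (set [0] \<union> set (map Suc [0..<m])) = {}"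
  then obtain q where qs: "qs = [q]"
    by (cases qs) auto
  show "Imp (counterexample m n) (subst (join_subst [0] qs) (counterexample m n))
    \<in> Log (cluster k)"
    unfolding Log_def mem_Collect_eq sat_Imp
  proof (intro allI impI ballI)
    fix V :: "nat \<Rightarrow> nat set" and w
    assume V: "\<forall>p. V p \<subseteq> fst (cluster k)" and "w \<in> fst (cluster k)"
      and sat: "sat (cluster k) V w (counterexample m n)"
    then have "w < k"
      by (simp add: cluster_def)
    have "sat (cluster k) (\<lambda>v. {u \<in> fst (cluster k). sat (cluster k) V u (join_subst [0] qs v)}) w
      (counterexample m n)"
      by (rule counterexample_mono[OF assms \<open>w < k\<close> _ _ sat])
        (use V in \<open>auto simp: join_subst_def qs cluster_def\<close>)
    with \<open>w \<in> fst (cluster k)\<close>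
    show "sat (cluster k) V w (subst (join_subst [0] qs) (counterexample m n))"
      by (simp add: sat_subst)
  qed
qed

text \<open>The witnessing model spreads the \<open>n\<close> types over the \<open>n + 1\<close> worlds cyclically, so that type \<open>0\<close> is
  repeated at the worlds \<open>0\<close> and \<open>n\<close>, and makes \<open>p\<close> true at \<open>n\<close> only.\<close>

lemma counterexample_not_positive:
  assumes "0 < n" "n \<le> 2 ^ m" "vars b \<subseteq> insert 0 (Suc ` {..<m})" "NegLit 0 \<notin> lits b"
  shows "Iff (counterexample m n) b \<notin> Log (cluster (n + 1))"
proof
  assume equiv: "Iff (counterexample m n) b \<in> Log (cluster (n + 1))"
  define V where "V v = (case v of 0 \<Rightarrow> {n} | Suc j \<Rightarrow> {u. u < n + 1 \<and> bit (u mod n) j})" for v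
  have V0: "V 0 = {n}"
    by (simp add: V_def)
  have type: "sat (cluster (n + 1)) V u (type_fm m (u mod n))" if "u < n + 1" for u
    using that by (auto simp: sat_type_fm V_def)
  have sat_b: "sat (cluster (n + 1)) V w (counterexample m n) \<longleftrightarrow> sat (cluster (n + 1)) V w b"
    if "w < n + 1" for w
  proof -
    have "\<forall>p. V p \<subseteq> fst (cluster (n + 1))"
      by (auto simp: V_def cluster_def split: nat.splits)
    then show ?thesis
      using equiv that by (auto simp: Log_def sat_Iff cluster_def)
  qed
  have type_0: "sat (cluster (n + 1)) V 0 (type_fm m 0)"
    using type[of 0] by simp
  have type_n: "sat (cluster (n + 1)) V n (type_fm m 0)"
    using type[of n] by simp
  have "\<exists>u<n + 1. sat (cluster (n + 1)) V u (type_fm m i)" if "i < n" for i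
    using type[of i] that by (intro exI[of _ i]) simp
  with type_0 type_n \<open>0 < n\<close> have "sat (cluster (n + 1)) V 0 (counterexample m n)"
    by (subst sat_counterexample) (auto simp: V0)
  then have "sat (cluster (n + 1)) V 0 b"
    using sat_b by simp
  then have "sat (cluster (n + 1)) V n b"
  proof (rule sat_cluster_positive_mono[rotated 3])
    fix l
    assume l: "l \<in> lits b" "sat (cluster (n + 1)) V 0 (Lit l)"
    \<comment> \<open>The worlds \<open>0\<close> and \<open>n\<close> agree on the parameters, and only \<open>n\<close> satisfies \<open>p\<close>.\<close>
    have "v = 0 \<or> (\<exists>j<m. v = Suc j)" if "l = PosLit v \<or> l = NegLit v" for v
      using assms(3) l(1) that by (auto simp: vars_def)
    with l assms(1,4) show "sat (cluster (n + 1)) V n (Lit l)"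
      by (cases l) (auto simp: V_def split: nat.splits)
  qed (use \<open>0 < n\<close> in auto)
  then have "sat (cluster (n + 1)) V n (counterexample m n)"
    using sat_b by simp
  with type_0 \<open>0 < n\<close> show False
    by (subst (asm) sat_counterexample) (auto simp: V0)
qed

theorem proposition4p8:
  fixes m k :: nat
  assumes "2 \<le> k" and "k \<le> 2 ^ m + 1"
  shows "\<not> LPP (Log (cluster k)) 1 (enat m)"
proof
  assume lpp: "LPP (Log (cluster k)) 1 (enat m)"
  define n where "n = k - 1"
  have n: "0 < n" "n \<le> 2 ^ m" "k = n + 1"
    using assms by (auto simp: n_def)
  have "enat (length [0 :: nat]) \<le> 1 \<and> enat (length (map Suc [0..<m])) \<le> enat m \<and>
      distinct ([0] @ map Suc [0..<m]) \<and>
      vars (counterexample m n) \<subseteq> set [0] \<union> set (map Suc [0..<m]) \<and>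
      monotone_in (Log (cluster k)) [0] (map Suc [0..<m]) (counterexample m n)"
    using vars_counterexample[of m n] monotone_in_counterexample[of n m k] n
    by (auto simp: one_enat_def distinct_map lessThan_atLeast0)
  then obtain b where "vars b \<subseteq> set [0] \<union> set (map Suc [0..<m])" "positive_in [0] b"
      "Iff (counterexample m n) b \<in> Log (cluster k)"
    using lpp unfolding LPP_def by blast
  then show False
    using counterexample_not_positive[OF n(1,2), of b] n(3)
    by (auto simp: positive_in_def lessThan_atLeast0)
qed

end
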